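(* For the complete graph $K_n$, the spectrum of the diminished Sombor matrix is $$\mathrm{Spec}(M_{DS}(K_n))=\left\{\frac{\sqrt2}{2}(n-1),\ \underbrace{-\frac{\sqrt2}{2},\dots,-\frac{\sqrt2}{2}}_{n-1\ \text{times}}\right\}$$ (as a multiset of eigenvalues).
   Context: For a finite simple graph $G$ with vertices $v_1,\dots,v_n$ and degrees $d_i=d_{v_i}$, the diminished Sombor matrix $M_{DS}(G)=(\mu_{ij})$ is the $n\times n$ real symmetric matrix with $\mu_{ij}=\frac{\sqrt{d_i^2+d_j^2}}{d_i+d_j}$ if $v_iv_j\in E(G)$, and $\mu_{ij}=0$ otherwise. *)

theory Defs
  imports
    "Graph_Theory.Graph_Theory"
    "Jordan_Normal_Form.Spectral_Radius"
begin

text \<open>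
  A finite simple graph is a digraph satisfying the locale \<^locale>\<open>graph\<close> (finite, loop-free,
  without parallel arcs, symmetric): an undirected edge is a pair of opposite arcs, so the degree of
  a vertex is its \<^const>\<open>out_degree\<close>. The list \<open>vs\<close> is the enumeration of the vertices that
  indexes rows and columns; it is meant to be distinct with \<open>set vs = verts G\<close>.
\<close>

definition diminished_sombor_matrix :: "('a, 'b) pre_digraph \<Rightarrow> 'a list \<Rightarrow> real mat" where
  "diminished_sombor_matrix G vs = mat (length vs) (length vs) (\<lambda>(i, j).
     if (vs ! i, vs ! j) \<in> arcs_ends G
     then sqrt (real (out_degree G (vs ! i)) ^ 2 + real (out_degree G (vs ! j)) ^ 2)
            / (real (out_degree G (vs ! i)) + real (out_degree G (vs ! j)))
     else 0)"

text \<open>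
  Eigenvalues counted with algebraic multiplicity. Only eigenvalues in the base field are
  collected; a real symmetric matrix has no others.
\<close>

definition spectrum_mset :: "'a :: field mat \<Rightarrow> 'a multiset" where
  "spectrum_mset A = proots (char_poly A)"

lemma set_mset_spectrum_mset:
  fixes A :: "'a :: field mat"
  assumes "A \<in> carrier_mat n n"
  shows "set_mset (spectrum_mset A) = spectrum A"
proof -
  have "char_poly A \<noteq> 0"
    using degree_monic_char_poly[OF assms] by auto
  then show ?thesis
    by (simp add: spectrum_mset_def spectrum_root_char_poly[OF assms])
qed

lemma (in graph) in_degree_eq_out_degree: "in_degree G v = out_degree G v"
proof -
  have inj: "inj_on (arc_to_ends G) (arcs G)"
    using no_multi_arcs by (auto intro: inj_onI)
  have "in_degree G v = card (arc_to_ends G ` in_arcs G v)"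
    unfolding in_degree_def
    by (intro card_image[symmetric] inj_on_subset[OF inj]) (auto simp: in_arcs_def)
  also have "arc_to_ends G ` in_arcs G v = {e \<in> arcs_ends G. snd e = v}"
    by (auto simp: arcs_ends_def arc_to_ends_def in_arcs_def)
  also have "\<dots> = prod.swap ` {e \<in> arcs_ends G. fst e = v}"
    using sym_arcs by (force simp: symmetric_def sym_def image_iff)
  also have "card \<dots> = card {e \<in> arcs_ends G. fst e = v}"
    by (intro card_image) (auto intro: inj_onI)
  also have "{e \<in> arcs_ends G. fst e = v} = arc_to_ends G ` out_arcs G v"
    by (auto simp: arcs_ends_def arc_to_ends_def out_arcs_def)
  also have "card \<dots> = out_degree G v"
    unfolding out_degree_def
    by (intro card_image inj_on_subset[OF inj]) (auto simp: out_arcs_def)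
  finally show ?thesis .
qed

lemma (in graph) transpose_diminished_sombor_matrix:
  "transpose_mat (diminished_sombor_matrix G vs) = diminished_sombor_matrix G vs"
  using sym_arcs
  by (intro eq_matI)
     (auto simp: diminished_sombor_matrix_def add.commute symmetric_def dest: symD)

end

theory Submission
  imports Defs
begin

text \<open>
  Adding the first row of a matrix to all other rows, and undoing this on the columns, is a
  conjugation. It brings a matrix with constant diagonal and constant off-diagonal entries to upper
  triangular form, because the all-ones vector becomes the first basis vector. The diminished Sombor
  matrix of a complete graph has this shape: all degrees equal \<open>n - 1\<close>, so its off-diagonal entries
  are \<open>sqrt 2 / 2\<close>.
\<close>

text \<open>Keeping the factor \<open>s\<close> as a parameter makes the inverse an instance of the
  same definition, at \<open>- s\<close>. Writing the entry as a sum of two deltas lets sums over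
  products split by \<open>sum.distrib\<close>.\<close>

definition add_first_row_mat :: "nat \<Rightarrow> 'a :: ring_1 \<Rightarrow> 'a mat" where
  "add_first_row_mat n s =
     mat n n (\<lambda>(i, j). (if j = i then 1 else 0) + (if j = 0 then if 0 < i then s else 0 else 0))"

lemma add_first_row_mat_carrier [simp]: "add_first_row_mat n s \<in> carrier_mat n n"
  by (simp add: add_first_row_mat_def)

lemma add_first_row_mat_mult:
  fixes A :: "'a :: ring_1 mat"
  assumes "A \<in> carrier_mat n m"
  shows "add_first_row_mat n s * A = mat n m (\<lambda>(i, j). A $$ (i, j) + (if 0 < i then s * A $$ (0, j) else 0))"
    (is "?L = ?R")
proof (rule eq_matI)
  fix i j assume "i < dim_row ?R" "j < dim_col ?R"
  then have ij: "i < n" "j < m" by simp_all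
  then have "?L $$ (i, j) = (\<Sum>k = 0..<n. ((if k = i then 1 else 0)
      + (if k = 0 then if 0 < i then s else 0 else 0)) * A $$ (k, j))"
    using assms by (simp add: add_first_row_mat_def scalar_prod_def)
  also have "\<dots> = (\<Sum>k = 0..<n. (if k = i then A $$ (k, j) else 0)
      + (if k = 0 then if 0 < i then s * A $$ (k, j) else 0 else 0))"
    by (intro sum.cong) (auto simp: algebra_simps)
  also have "\<dots> = ?R $$ (i, j)"
    using ij by (simp add: sum.distrib)
  finally show "?L $$ (i, j) = ?R $$ (i, j)" .
qed (use assms in \<open>auto simp: add_first_row_mat_def\<close>)

text \<open>The first row itself stays unchanged, so adding \<open>s\<close> times it to the others
  cancels adding \<open>- s\<close> times it.\<close>

lemma add_first_row_mat_inverse: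
  "add_first_row_mat n s * add_first_row_mat n (- s) = 1\<^sub>m n"
  by (subst add_first_row_mat_mult[of _ n n])
     (auto simp: add_first_row_mat_def intro!: eq_matI)

lemma char_poly_const_diag_const_off_diag:
  fixes a b :: "'a :: comm_ring_1"
  shows "char_poly (mat (Suc n) (Suc n) (\<lambda>(i, j). if i = j then a else b))
    = [:- (a + of_nat n * b), 1:] * [:- (a - b), 1:] ^ n"
proof -
  let ?N = "Suc n"
  define A where "A = mat ?N ?N (\<lambda>(i, j). if i = j then a else b)"
  \<comment> \<open>This is \<open>A\<close> in the basis consisting of the all-ones vector
    \<open>u\<close> and the unit vectors \<open>e_j\<close> for \<open>0 < j\<close>:
    \<open>A u = (a + n b) u\<close> and \<open>A e_j = b u + (a - b) e_j\<close>. No division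
    occurs, so any commutative ring will do.\<close>
  define B where "B = mat ?N ?N (\<lambda>(i, j). if i = 0 then if j = 0 then a + of_nat n * b else b
    else if i = j then a - b else 0)"
  let ?L = "add_first_row_mat ?N (1 :: 'a)" and ?L' = "add_first_row_mat ?N (- 1 :: 'a)"
  have A: "A \<in> carrier_mat ?N ?N" and B: "B \<in> carrier_mat ?N ?N"
    by (simp_all add: A_def B_def)
  have row_sum: "(\<Sum>k = 0..<?N. if k = i then a else b) = a + of_nat n * b" if "i < ?N" for i
  proof -
    have "(\<Sum>k = 0..<?N. if k = i then a else b) = (\<Sum>k = 0..<?N. (if k = i then a - b else 0) + b)"
      by (intro sum.cong) auto
    also have "\<dots> = a + of_nat n * b"
      using that by (simp add: sum.distrib algebra_simps del: sum.op_ivl_Suc)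
    finally show ?thesis .
  qed
  have "A * ?L = ?L * B"
  proof (rule eq_matI)
    fix i j assume "i < dim_row (?L * B)" "j < dim_col (?L * B)"
    then have ij: "i < ?N" "j < ?N" using B by (auto simp: add_first_row_mat_def)
    have "(A * ?L) $$ (i, j) = (\<Sum>k = 0..<?N. (if k = i then a else b) *
        ((if k = j then 1 else 0) + (if j = 0 then if 0 < k then 1 else 0 else 0)))"
      using ij by (auto simp: A_def add_first_row_mat_def scalar_prod_def intro!: sum.cong)
    \<comment> \<open>Column 0 of \<open>?L\<close> is all ones and yields the row sums of
      \<open>A\<close>; every other column is a unit vector and picks out a column of
      \<open>A\<close>.\<close>
    also have "\<dots> = (\<Sum>k = 0..<?N. if j = 0 then if k = i then a else b
        else if k = j then if k = i then a else b else 0)"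
      by (intro sum.cong) auto
    also have "\<dots> = (if j = 0 then a + of_nat n * b else if i = j then a else b)"
      using ij row_sum[of i] by (cases "j = 0") (auto simp del: sum.op_ivl_Suc)
    also have "\<dots> = (?L * B) $$ (i, j)"
      unfolding add_first_row_mat_mult[OF B] using ij by (auto simp: B_def)
    finally show "(A * ?L) $$ (i, j) = (?L * B) $$ (i, j)" .
  qed (auto simp: A_def B_def add_first_row_mat_def)
  moreover have LL': "?L * ?L' = 1\<^sub>m ?N" and L'L: "?L' * ?L = 1\<^sub>m ?N"
    \<comment> \<open>The instance at \<open>- 1\<close> gives the inverse on the other side, since
      \<open>- (- 1) = 1\<close>.\<close>
    using add_first_row_mat_inverse[of ?N "1 :: 'a"] add_first_row_mat_inverse[of ?N "- 1 :: 'a"]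
    by simp_all
  ultimately have "?L * B * ?L' = A * (?L * ?L')"
    using assoc_mult_mat[OF A, of ?L ?N ?L' ?N] by simp
  then have "A = ?L * B * ?L'"
    using LL' A by simp
  then have "similar_mat A B"
    using A B LL' L'L by (intro similar_matI[of A B ?L ?L' ?N]) auto
  then have "char_poly A = char_poly B"
    by (rule char_poly_similar)
  also have "\<dots> = (\<Prod>x\<leftarrow>diag_mat B. [:- x, 1:])"
    by (rule char_poly_upper_triangular[OF B]) (auto simp: B_def)
  also have "diag_mat B = (a + of_nat n * b) # replicate n (a - b)"
    by (rule nth_equalityI) (auto simp: diag_mat_def B_def nth_Cons' simp del: upt_Suc)
  finally show ?thesis
    by (simp add: A_def)
qed

text \<open>Without parallel arcs, an arc leaving \<open>v\<close> is determined by its head. This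
  reads degrees off the adjacency relation, through which \<open>complete_digraph\<close> is
  specified.\<close>

lemma (in graph) out_degree_eq_card_arcs_ends:
  "out_degree G v = card {w. (v, w) \<in> arcs_ends G}"
proof -
  have "inj_on (head G) (out_arcs G v)"
    using no_multi_arcs by (auto intro!: inj_onI simp: arc_to_ends_def)
  then have "out_degree G v = card (head G ` out_arcs G v)"
    unfolding out_degree_def by (rule card_image[symmetric])
  also have "head G ` out_arcs G v = {w. (v, w) \<in> arcs_ends G}"
    by (auto simp: arcs_ends_def arc_to_ends_def)
  finally show ?thesis .
qed

lemma out_degree_complete_digraph:
  assumes "complete_digraph n G" "v \<in> verts G"
  shows "out_degree G v = n - 1"
proof -
  interpret graph G using assms by (simp add: complete_digraph_def)
  have "{w. (v, w) \<in> arcs_ends G} = verts G - {v}"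
    using assms by (auto simp: complete_digraph_def)
  then show ?thesis
    using assms by (simp add: out_degree_eq_card_arcs_ends complete_digraph_def)
qed

lemma diminished_sombor_matrix_complete_digraph:
  assumes "complete_digraph n G" "distinct vs" "set vs = verts G"
  shows "diminished_sombor_matrix G vs = mat n n (\<lambda>(i, j). if i = j then 0 else sqrt 2 / 2)"
proof -
  have len: "length vs = n"
    using assms distinct_card[of vs] by (simp add: complete_digraph_def)
  \<comment> \<open>Two distinct indices below \<open>n\<close> force \<open>n > 1\<close>, so the
    common degree is positive and can be cancelled wherever an off-diagonal entry exists.\<close>
  have "sqrt ((real (n - 1))\<^sup>2 + (real (n - 1))\<^sup>2) / (real (n - 1) + real (n - 1)) = sqrt 2 / 2"
    if "n > 1"
    using that by (simp add: real_sqrt_mult field_simps flip: mult_2)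
  then show ?thesis
    using assms unfolding diminished_sombor_matrix_def len
    by (intro cong_mat refl)
       (auto simp: out_degree_complete_digraph[OF assms(1)] nth_eq_iff_index_eq len complete_digraph_def)
qed

theorem corollary3p2:
  fixes G :: "('a, 'b) pre_digraph" and vs :: "'a list" and n :: nat
  assumes "n \<ge> 1"
    and "complete_digraph n G"
    and "distinct vs" and "set vs = verts G"
  shows "spectrum_mset (diminished_sombor_matrix G vs)
    = add_mset (sqrt 2 / 2 * (real n - 1)) (replicate_mset (n - 1) (- (sqrt 2 / 2)))"
proof -
  \<comment> \<open>With \<open>a = 0\<close> and \<open>b = sqrt 2 / 2\<close>, the simple factor
    has root \<open>m * b\<close>, where \<open>m = n - 1\<close>, and the \<open>m\<close>-fold
    factor has root \<open>- b\<close>.\<close>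
  obtain m where n: "n = Suc m" using assms(1) by (cases n) auto
  show ?thesis
    unfolding spectrum_mset_def diminished_sombor_matrix_complete_digraph[OF assms(2-4)] n
      char_poly_const_diag_const_off_diag
    by (subst proots_mult) (auto simp: proots_power)
qed

end
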